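(* Let $H$ be a hyperfield, let $F_H$ be its associated tract and $P_H$ its associated pasture. Then $F_H=\overline{P_H}$ (that is, these two tracts, which have the same underlying monoid $H$, have the same null set).
   Context: For an abelian group $G$, $\mathbb{N}[G]$ is the group semiring (finite formal sums of elements of $G$); $\|\alpha\|$ is the number $m$ such that $\alpha$ is a sum of $m$ elements of $G$ ($\|0\|=0$), and $\mathbb{N}[G]_{\leq 3}=\{\alpha:\|\alpha\|\leq 3\}$. A tract (resp. pasture) is a multiplicatively written commutative monoid $F$ with an absorbing element $0$ such that $F^\times:=F\setminus\{0\}$ is a group, together with a subset $N_F$ (the null set) of $\mathbb{N}[F^\times]$ (resp. of $\mathbb{N}[F^\times]_{\leq 3}$) such that: (T1) the zero element belongs to $N_F$; (T2) there is a unique $\epsilon\in F^\times$ with $1+\epsilon\in N_F$; (T3) $N_F$ is closed under the natural action of $F^\times$. One writes $-\alpha=\epsilon\alpha$, $\alpha-\beta=\alpha+\epsilon\beta$, and regards $F\subseteq\mathbb{N}[F^\times]$ with $0\in F$ identified with the zero of $\mathbb{N}[F^\times]$. Fusion axiom (F) for a subset $N\subseteq\mathbb{N}[F^\times]$: if $\alpha+z$ and $\beta-z$ are in $N$ with $\alpha,\beta\in\mathbb{N}[F^\times]$ and $z\in F$, then $\alpha+\beta\in N$. For a pasture $P$, $\overline{P}$ is the tract with multiplicative group $P^\times$ whose null set is the smallest subset of $\mathbb{N}[P^\times]$ containing $N_P$ and satisfying (F). A commutative hypergroup is a set $G$ with an element $0$ and a map $\boxplus:G\times G\to\mathcal{P}(G)$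 (power set) such that for all $a,b,c\in G$: $a\boxplus b\neq\emptyset$; $\bigcup_{d\in b\boxplus c}a\boxplus d=\bigcup_{d\in a\boxplus b}d\boxplus c$; $0\boxplus a=a\boxplus 0=\{a\}$; there is a unique element $-a$ with $0\in a\boxplus(-a)$; $a\boxplus b=b\boxplus a$; and $c\in a\boxplus b$ iff $b\in c\boxplus(-a)$. Multiple hypersums are defined recursively by $\boxplus_{i=1}^n a_i=\bigcup_{b\in\boxplus_{i=1}^{n-1}a_i}b\boxplus a_n$ (the one-term hypersum being $\{a_1\}$ and the empty one $\{0\}$). A (commutative) hyperring is a set $R$ with elements $0,1$, a hyperaddition $\boxplus$ and a multiplication $\cdot$ such that $(R,\boxplus,0)$ is a commutative hypergroup, $(R,\cdot,1)$ is a commutative monoid, $0\cdot a=a\cdot 0=0$, and $a\cdot(b\boxplus c)=ab\boxplus ac$ where $a\cdot(b\boxplus c)=\{ad: d\in b\boxplus c\}$. A hyperfield is a hyperring $H$ with $0\neq 1$ in which every nonzero element has a multiplicative inverse. The tract $F_H$ associated to a hyperfield $H$ has multiplicative group $H^\times=H\setminus\{0\}$ and null set consisting of the sums $\sum_{i=1}^k x_i$ ($x_i\in H^\times$, $k\ge 0$) with $0\in\boxplus_{i=1}^k x_i$; the pasture $P_H$ has multiplicative group $H^\times$ and $x+y+z\in N_{P_H}$ iff $0\in x\boxplus y\boxplus z$ (for $x,y,z\in H$). *)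

theory Defs
  imports "HOL-Library.Multiset" "HOL-Algebra.Group"
begin

section \<open>Monoids with zero and group semirings\<close>

record 'a zmonoid = "'a monoid" +
  zero :: 'a (\<open>\<zero>\<index>\<close>)

definition nonzero :: "('a, 'm) zmonoid_scheme \<Rightarrow> 'a set" where
  "nonzero F = carrier F - {\<zero>\<^bsub>F\<^esub>}"

locale zmonoid = comm_monoid F for F (structure) +
  assumes zero_closed [simp]: "\<zero> \<in> carrier F"
    and zero_left [simp]: "a \<in> carrier F \<Longrightarrow> \<zero> \<otimes> a = \<zero>"
    and zero_right [simp]: "a \<in> carrier F \<Longrightarrow> a \<otimes> \<zero> = \<zero>"

text \<open>An element of the group semiring over \<open>G\<close>, i.e. a finite formal sum of elements of \<open>G\<close>, is
  a multiset with elements in \<open>G\<close>. Its norm is the \<^const>\<open>size\<close> of the multiset.\<close>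

definition group_semiring :: "'a set \<Rightarrow> 'a multiset set" where
  "group_semiring G = {\<alpha>. set_mset \<alpha> \<subseteq> G}"

text \<open>The inclusion of \<open>F\<close> into the group semiring of its units, which sends the zero of \<open>F\<close> to the
  empty sum.\<close>

definition formal :: "('a, 'm) zmonoid_scheme \<Rightarrow> 'a \<Rightarrow> 'a multiset" where
  "formal F x = (if x = \<zero>\<^bsub>F\<^esub> then {#} else {#x#})"


section \<open>Tracts and pastures\<close>

text \<open>Tracts and pastures share the same kind of data and differ only in the bound on the norm of
  the elements of the null set.\<close>

record 'a tract = "'a zmonoid" +
  null :: "'a multiset set"

locale tract = zmonoid F for F (structure) +
  assumes nonzero_group: "group \<lparr>carrier = nonzero F, mult = mult F, one = \<one>\<rparr>"
    and null_subset: "null F \<subseteq> group_semiring (nonzero F)"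
    and T1: "{#} \<in> null F"
    and T2: "\<exists>!\<epsilon>. \<epsilon> \<in> nonzero F \<and> {#\<one>#} + {#\<epsilon>#} \<in> null F"
    and T3: "a \<in> nonzero F \<Longrightarrow> \<alpha> \<in> null F \<Longrightarrow> image_mset (\<lambda>x. a \<otimes> x) \<alpha> \<in> null F"

locale pasture = tract F for F (structure) +
  assumes size_null_le: "\<alpha> \<in> null F \<Longrightarrow> size \<alpha> \<le> 3"

definition minus_one :: "('a, 'm) tract_scheme \<Rightarrow> 'a" where
  "minus_one F = (THE \<epsilon>. \<epsilon> \<in> nonzero F \<and> {#\<one>\<^bsub>F\<^esub>#} + {#\<epsilon>#} \<in> null F)"

definition fusion :: "('a, 'm) tract_scheme \<Rightarrow> 'a multiset set \<Rightarrow> bool" where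
  "fusion F N \<longleftrightarrow>
    (\<forall>\<alpha> \<in> group_semiring (nonzero F). \<forall>\<beta> \<in> group_semiring (nonzero F). \<forall>z \<in> carrier F.
      \<alpha> + formal F z \<in> N \<longrightarrow> \<beta> + formal F (minus_one F \<otimes>\<^bsub>F\<^esub> z) \<in> N \<longrightarrow> \<alpha> + \<beta> \<in> N)"

definition fusion_closure :: "'a tract \<Rightarrow> 'a tract" where
  "fusion_closure P =
    P\<lparr>null := \<Inter>{N. N \<subseteq> group_semiring (nonzero P) \<and> null P \<subseteq> N \<and> fusion P N}\<rparr>"


section \<open>Hyperfields\<close>

record 'a hyperring = "'a zmonoid" +
  hyperadd :: "'a \<Rightarrow> 'a \<Rightarrow> 'a set" (infixl \<open>\<boxplus>\<index>\<close> 65)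

definition hyperneg :: "('a, 'm) hyperring_scheme \<Rightarrow> 'a \<Rightarrow> 'a" where
  "hyperneg H a = (THE b. b \<in> carrier H \<and> \<zero>\<^bsub>H\<^esub> \<in> a \<boxplus>\<^bsub>H\<^esub> b)"

locale comm_hypergroup =
  fixes H (structure)
  assumes hyperadd_zero_closed: "\<zero> \<in> carrier H"
    and hyperadd_closed: "a \<in> carrier H \<Longrightarrow> b \<in> carrier H \<Longrightarrow> a \<boxplus> b \<subseteq> carrier H"
    and hyperadd_nonempty: "a \<in> carrier H \<Longrightarrow> b \<in> carrier H \<Longrightarrow> a \<boxplus> b \<noteq> {}"
    and hyperadd_assoc: "a \<in> carrier H \<Longrightarrow> b \<in> carrier H \<Longrightarrow> c \<in> carrier H \<Longrightarrow>
      (\<Union>d \<in> b \<boxplus> c. a \<boxplus> d) = (\<Union>d \<in> a \<boxplus> b. d \<boxplus> c)"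
    and hyperadd_zero_left: "a \<in> carrier H \<Longrightarrow> \<zero> \<boxplus> a = {a}"
    and hyperadd_zero_right: "a \<in> carrier H \<Longrightarrow> a \<boxplus> \<zero> = {a}"
    and hyperadd_inverse: "a \<in> carrier H \<Longrightarrow> \<exists>!b. b \<in> carrier H \<and> \<zero> \<in> a \<boxplus> b"
    and hyperadd_comm: "a \<in> carrier H \<Longrightarrow> b \<in> carrier H \<Longrightarrow> a \<boxplus> b = b \<boxplus> a"
    and hyperadd_reversible: "a \<in> carrier H \<Longrightarrow> b \<in> carrier H \<Longrightarrow> c \<in> carrier H \<Longrightarrow>
      c \<in> a \<boxplus> b \<longleftrightarrow> b \<in> c \<boxplus> hyperneg H a"

locale hyperring = zmonoid H + comm_hypergroup H for H (structure) +
  assumes distrib: "a \<in> carrier H \<Longrightarrow> b \<in> carrier H \<Longrightarrow> c \<in> carrier H \<Longrightarrow>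
      (\<lambda>d. a \<otimes> d) ` (b \<boxplus> c) = (a \<otimes> b) \<boxplus> (a \<otimes> c)"

locale hyperfield = hyperring H for H (structure) +
  assumes zero_neq_one: "\<zero> \<noteq> \<one>"
    and nonzero_Units: "nonzero H \<subseteq> Units H"

fun hypersum :: "('a, 'm) hyperring_scheme \<Rightarrow> 'a list \<Rightarrow> 'a set" where
  "hypersum H [] = {\<zero>\<^bsub>H\<^esub>}"
| "hypersum H (x # xs) = foldl (\<lambda>B a. \<Union>b \<in> B. b \<boxplus>\<^bsub>H\<^esub> a) {x} xs"

lemma hypersum_snoc:
  "xs \<noteq> [] \<Longrightarrow> hypersum H (xs @ [a]) = (\<Union>b \<in> hypersum H xs. b \<boxplus>\<^bsub>H\<^esub> a)"
  by (cases xs) auto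

text \<open>A formal sum may be written with its terms in any order; membership in the null sets below
  asks for some order. The order is immaterial, because the hypersum is commutative and
  associative.\<close>

definition hyperfield_tract :: "('a, 'm) hyperring_scheme \<Rightarrow> 'a tract" where
  "hyperfield_tract H =
    \<lparr>carrier = carrier H, mult = mult H, one = \<one>\<^bsub>H\<^esub>, zero = \<zero>\<^bsub>H\<^esub>,
     null = {mset xs | xs. set xs \<subseteq> nonzero H \<and> \<zero>\<^bsub>H\<^esub> \<in> hypersum H xs}\<rparr>"

definition hyperfield_pasture :: "('a, 'm) hyperring_scheme \<Rightarrow> 'a tract" where
  "hyperfield_pasture H =
    \<lparr>carrier = carrier H, mult = mult H, one = \<one>\<^bsub>H\<^esub>, zero = \<zero>\<^bsub>H\<^esub>,
     null = {formal H x + formal H y + formal H z | x y z.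
       x \<in> carrier H \<and> y \<in> carrier H \<and> z \<in> carrier H \<and> \<zero>\<^bsub>H\<^esub> \<in> hypersum H [x, y, z]}\<rparr>"


section \<open>The structures attached to a hyperfield are a tract and a pasture\<close>

context hyperfield
begin

lemma nonzero_group_H: "group \<lparr>carrier = nonzero H, mult = mult H, one = \<one>\<rparr>"
proof (rule groupI, simp_all)
  fix x y assume xy: "x \<in> nonzero H" "y \<in> nonzero H"
  then have c: "x \<in> Units H" "x \<in> carrier H" "y \<in> carrier H" "y \<noteq> \<zero>"
    using nonzero_Units by (auto simp: nonzero_def)
  have "x \<otimes> y \<noteq> \<zero>"
    using c by (metis Units_inv_closed Units_l_inv l_one m_assoc zero_right)
  then show "x \<otimes> y \<in> nonzero H" using c by (simp add: nonzero_def)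
next
  show "\<one> \<in> nonzero H" using zero_neq_one by (auto simp: nonzero_def)
next
  fix x y z assume "x \<in> nonzero H" "y \<in> nonzero H" "z \<in> nonzero H"
  then show "x \<otimes> y \<otimes> z = x \<otimes> (y \<otimes> z)" by (simp add: nonzero_def m_assoc)
next
  fix x assume "x \<in> nonzero H"
  then show "\<one> \<otimes> x = x" by (simp add: nonzero_def)
next
  fix x assume x: "x \<in> nonzero H"
  then have u: "x \<in> Units H" "x \<in> carrier H" using nonzero_Units by (auto simp: nonzero_def)
  have "inv x \<noteq> \<zero>" using Units_l_inv[OF u(1)] zero_neq_one u(2) by auto
  then show "\<exists>y\<in>nonzero H. y \<otimes> x = \<one>" using u by (auto simp: nonzero_def intro!: bexI[of _ "inv x"])
qed

lemma mult_nonzero: "a \<in> nonzero H \<Longrightarrow> b \<in> nonzero H \<Longrightarrow> a \<otimes> b \<in> nonzero H"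
  using monoid.m_closed[OF group.is_monoid[OF nonzero_group_H]] by simp

lemma hypersum_closed: "set xs \<subseteq> carrier H \<Longrightarrow> hypersum H xs \<subseteq> carrier H"
proof (induction xs rule: rev_induct)
  case (snoc a xs)
  show ?case
  proof (cases "xs = []")
    case False
    have "b \<boxplus> a \<subseteq> carrier H" if "b \<in> hypersum H xs" for b
      using that snoc hyperadd_closed[of b a] by auto
    then show ?thesis
      using False by (simp add: hypersum_snoc UN_subset_iff)
  qed (use snoc in simp)
qed simp

lemma hypersum_mult:
  assumes "a \<in> carrier H" "set xs \<subseteq> carrier H"
  shows "hypersum H (map (\<lambda>x. a \<otimes> x) xs) = (\<lambda>x. a \<otimes> x) ` hypersum H xs"
  using assms(2)
proof (induction xs rule: rev_induct)
  case (snoc b xs)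
  show ?case
  proof (cases "xs = []")
    case False
    have "(\<lambda>x. a \<otimes> x) ` (c \<boxplus> b) = (a \<otimes> c) \<boxplus> (a \<otimes> b)" if "c \<in> hypersum H xs" for c
      using that snoc.prems hypersum_closed[of xs] distrib[OF assms(1), of c b] by auto
    then show ?thesis
      using False snoc by (simp add: hypersum_snoc image_UN)
  qed simp
qed (simp add: assms)

lemma hypersum_3: "hypersum H [x, y, z] = (\<Union>b \<in> x \<boxplus> y. b \<boxplus> z)"
  by simp

lemma hypersum_swap12:
  assumes "x \<in> carrier H" "y \<in> carrier H" "z \<in> carrier H"
  shows "hypersum H [x, y, z] = hypersum H [y, x, z]"
  unfolding hypersum_3 by (subst hyperadd_comm[OF assms(1,2)]) (rule refl)

lemma hypersum_swap23:
  assumes "x \<in> carrier H" "y \<in> carrier H" "z \<in> carrier H"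
  shows "hypersum H [x, y, z] = hypersum H [x, z, y]"
proof -
  have "hypersum H [x, y, z] = (\<Union>d \<in> y \<boxplus> z. x \<boxplus> d)"
    unfolding hypersum_3 by (rule hyperadd_assoc[OF assms, symmetric])
  also have "\<dots> = (\<Union>d \<in> z \<boxplus> y. x \<boxplus> d)"
    by (subst hyperadd_comm[OF assms(2,3)]) (rule refl)
  also have "\<dots> = hypersum H [x, z, y]"
    unfolding hypersum_3 by (rule hyperadd_assoc[OF assms(1,3,2)])
  finally show ?thesis .
qed

lemma hypersum_3_cong:
  assumes "{#x, y, z#} = {#x', y', z'#}" "{x, y, z} \<subseteq> carrier H"
  shows "hypersum H [x, y, z] = hypersum H [x', y', z']"
proof -
  have c: "x \<in> carrier H" "y \<in> carrier H" "z \<in> carrier H"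
    using assms(2) by auto
  note s = hypersum_swap12 hypersum_swap23
  have e: "hypersum H [x, z, y] = hypersum H [x, y, z]" "hypersum H [y, x, z] = hypersum H [x, y, z]"
    by (rule s(2)[OF c(1,3,2)], rule s(1)[OF c(2,1,3)])
  have e': "hypersum H [y, z, x] = hypersum H [x, y, z]" "hypersum H [z, x, y] = hypersum H [x, y, z]"
    using s(2)[OF c(2,1,3)] s(1)[OF c(1,3,2)] e by argo+
  have e'': "hypersum H [z, y, x] = hypersum H [x, y, z]"
    using s(2)[OF c(3,1,2)] e' by argo
  have "(x = x' \<and> y = y' \<and> z = z') \<or> (x = x' \<and> y = z' \<and> z = y') \<or>
    (x = y' \<and> y = x' \<and> z = z') \<or> (x = y' \<and> y = z' \<and> z = x') \<or>
    (x = z' \<and> y = x' \<and> z = y') \<or> (x = z' \<and> y = y' \<and> z = x')"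
    using assms(1) by (auto simp: add_eq_conv_ex add_mset_eq_singleton_iff)
  then show ?thesis
    using e e' e'' by (elim disjE conjE) (simp_all del: hypersum.simps)
qed

lemma hyperfield_pasture_null_iff:
  assumes "x \<in> carrier H" "y \<in> carrier H" "z \<in> carrier H"
  shows "formal H x + formal H y + formal H z \<in> null (hyperfield_pasture H) \<longleftrightarrow>
    \<zero> \<in> hypersum H [x, y, z]"
proof
  assume "formal H x + formal H y + formal H z \<in> null (hyperfield_pasture H)"
  then obtain x' y' z' where *: "x' \<in> carrier H" "y' \<in> carrier H" "z' \<in> carrier H"
      "\<zero> \<in> hypersum H [x', y', z']"
      "formal H x + formal H y + formal H z = formal H x' + formal H y' + formal H z'"
    by (auto simp: hyperfield_pasture_def)
  have split: "{#a, b, c#} = formal H a + formal H b + formal H c +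
      replicate_mset (3 - size (formal H a + formal H b + formal H c)) \<zero>" for a b c
    by (auto simp: formal_def numeral_eq_Suc)
  have "{#x, y, z#} = {#x', y', z'#}"
    using split[of x y z] split[of x' y' z'] *(5) by simp
  then show "\<zero> \<in> hypersum H [x, y, z]"
    using hypersum_3_cong assms *(4) by blast
next
  assume "\<zero> \<in> hypersum H [x, y, z]"
  then show "formal H x + formal H y + formal H z \<in> null (hyperfield_pasture H)"
    using assms unfolding hyperfield_pasture_def tract.simps mem_Collect_eq by blast
qed

lemma formal_nonzero: "x \<in> carrier H \<Longrightarrow> set_mset (formal H x) \<subseteq> nonzero H"
  by (simp add: formal_def nonzero_def)

lemma unique_minus_one: "\<exists>!\<epsilon>. \<epsilon> \<in> nonzero H \<and> \<zero> \<in> \<one> \<boxplus> \<epsilon>"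
  using hyperadd_inverse[of \<one>] hyperadd_zero_right[of \<one>] zero_neq_one
  by (auto simp: nonzero_def)

lemma tract_hyperfield_tract: "tract (hyperfield_tract H)"
proof -
  interpret F: zmonoid "hyperfield_tract H"
    by unfold_locales (auto simp: hyperfield_tract_def m_ac)
  have nz: "nonzero (hyperfield_tract H) = nonzero H"
    by (simp add: hyperfield_tract_def nonzero_def)
  show ?thesis
  proof (intro tract.intro tract_axioms.intro F.zmonoid_axioms)
    show "group \<lparr>carrier = nonzero (hyperfield_tract H), mult = mult (hyperfield_tract H),
        one = \<one>\<^bsub>hyperfield_tract H\<^esub>\<rparr>"
      unfolding nz using nonzero_group_H by (simp add: hyperfield_tract_def)
    show "null (hyperfield_tract H) \<subseteq> group_semiring (nonzero (hyperfield_tract H))"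
      unfolding nz by (auto simp: hyperfield_tract_def group_semiring_def)
    show "{#} \<in> null (hyperfield_tract H)"
      by (auto simp: hyperfield_tract_def intro!: exI[of _ "[]"])
    have "{#\<one>#} + {#e#} \<in> null (hyperfield_tract H) \<longleftrightarrow> \<zero> \<in> \<one> \<boxplus> e" if e: "e \<in> nonzero H" for e
    proof
      assume "{#\<one>#} + {#e#} \<in> null (hyperfield_tract H)"
      then obtain xs where "mset xs = {#\<one>#} + {#e#}" and s: "\<zero> \<in> hypersum H xs"
        unfolding hyperfield_tract_def tract.simps mem_Collect_eq by metis
      then have xs: "mset xs = {#\<one>, e#}" by simp
      then have "length xs = 2" by (metis size_mset size_add_mset size_empty Suc_1 One_nat_def)
      then obtain a b where ab: "xs = [a, b]"
        by (auto simp: numeral_eq_Suc length_Suc_conv)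
      then have "(a = \<one> \<and> b = e) \<or> (a = e \<and> b = \<one>)"
        using xs by (auto simp: add_eq_conv_ex add_mset_eq_singleton_iff)
      then show "\<zero> \<in> \<one> \<boxplus> e"
        using s ab e hyperadd_comm[of e \<one>] by (elim disjE) (simp_all add: nonzero_def)
    next
      assume "\<zero> \<in> \<one> \<boxplus> e"
      then show "{#\<one>#} + {#e#} \<in> null (hyperfield_tract H)"
        using e zero_neq_one
        by (auto simp: hyperfield_tract_def nonzero_def intro!: exI[of _ "[\<one>, e]"])
    qed
    then show "\<exists>!\<epsilon>. \<epsilon> \<in> nonzero (hyperfield_tract H) \<and>
        {#\<one>\<^bsub>hyperfield_tract H\<^esub>#} + {#\<epsilon>#} \<in> null (hyperfield_tract H)"
      unfolding nz using unique_minus_one by (simp add: hyperfield_tract_def cong: conj_cong)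
  next
    fix a \<alpha> assume a: "a \<in> nonzero (hyperfield_tract H)" and "\<alpha> \<in> null (hyperfield_tract H)"
    then obtain xs where xs: "\<alpha> = mset xs" "set xs \<subseteq> nonzero H" "\<zero> \<in> hypersum H xs"
      by (auto simp: hyperfield_tract_def)
    have a': "a \<in> nonzero H" "a \<in> carrier H" using a nz by (auto simp: nonzero_def)
    have "\<zero> \<in> hypersum H (map (\<lambda>x. a \<otimes> x) xs)"
      using hypersum_mult[of a xs] xs a' by (force simp: nonzero_def)
    moreover have "set (map (\<lambda>x. a \<otimes> x) xs) \<subseteq> nonzero H"
      using xs(2) a' mult_nonzero by auto
    ultimately show "image_mset (\<lambda>x. a \<otimes>\<^bsub>hyperfield_tract H\<^esub> x) \<alpha> \<in> null (hyperfield_tract H)"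
      using xs(1) by (force simp: hyperfield_tract_def simp flip: mset_map)
  qed
qed

lemma pasture_hyperfield_pasture: "pasture (hyperfield_pasture H)"
proof -
  interpret F: zmonoid "hyperfield_pasture H"
    by unfold_locales (auto simp: hyperfield_pasture_def m_ac)
  have nz: "nonzero (hyperfield_pasture H) = nonzero H"
    by (simp add: hyperfield_pasture_def nonzero_def)
  show ?thesis
  proof (intro pasture.intro pasture_axioms.intro tract.intro tract_axioms.intro F.zmonoid_axioms)
    show "group \<lparr>carrier = nonzero (hyperfield_pasture H), mult = mult (hyperfield_pasture H),
        one = \<one>\<^bsub>hyperfield_pasture H\<^esub>\<rparr>"
      unfolding nz using nonzero_group_H by (simp add: hyperfield_pasture_def)
    show "null (hyperfield_pasture H) \<subseteq> group_semiring (nonzero (hyperfield_pasture H))"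
      unfolding nz
      using formal_nonzero by (fastforce simp: hyperfield_pasture_def group_semiring_def)
    show "{#} \<in> null (hyperfield_pasture H)"
      using hyperfield_pasture_null_iff[of \<zero> \<zero> \<zero>] hyperadd_zero_left[of \<zero>]
      by (simp add: formal_def)
    have "{#\<one>#} + {#e#} \<in> null (hyperfield_pasture H) \<longleftrightarrow> \<zero> \<in> \<one> \<boxplus> e"
      if e: "e \<in> nonzero H" for e
    proof -
      have "hypersum H [\<one>, e, \<zero>] = \<one> \<boxplus> e"
        using e hyperadd_closed[of \<one> e] hyperadd_zero_right by (auto simp: nonzero_def subset_iff)
      then show ?thesis
        using hyperfield_pasture_null_iff[of \<one> e \<zero>] e zero_neq_one
        by (simp add: formal_def nonzero_def add_mset_commute[of \<one> e] del: hypersum.simps)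
    qed
    then show "\<exists>!\<epsilon>. \<epsilon> \<in> nonzero (hyperfield_pasture H) \<and>
        {#\<one>\<^bsub>hyperfield_pasture H\<^esub>#} + {#\<epsilon>#} \<in> null (hyperfield_pasture H)"
      unfolding nz using unique_minus_one by (simp add: hyperfield_pasture_def cong: conj_cong)
  next
    fix a \<alpha> assume a: "a \<in> nonzero (hyperfield_pasture H)" and "\<alpha> \<in> null (hyperfield_pasture H)"
    then obtain x y z where c: "x \<in> carrier H" "y \<in> carrier H" "z \<in> carrier H"
      and s: "\<zero> \<in> hypersum H [x, y, z]" and \<alpha>: "\<alpha> = formal H x + formal H y + formal H z"
      by (auto simp: hyperfield_pasture_def)
    have a': "a \<in> nonzero H" "a \<in> carrier H" using a nz by (auto simp: nonzero_def)
    have "image_mset (\<lambda>x. a \<otimes> x) (formal H u) = formal H (a \<otimes> u)" if "u \<in> carrier H" for u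
      using that mult_nonzero[OF a'(1), of u] a' by (auto simp: formal_def nonzero_def)
    then have "image_mset (\<lambda>x. a \<otimes> x) \<alpha> =
        formal H (a \<otimes> x) + formal H (a \<otimes> y) + formal H (a \<otimes> z)"
      using c \<alpha> by simp
    moreover have "\<zero> \<in> (\<lambda>x. a \<otimes> x) ` hypersum H [x, y, z]"
      using s a' by (intro image_eqI[of _ _ \<zero>]) auto
    then have "\<zero> \<in> hypersum H [a \<otimes> x, a \<otimes> y, a \<otimes> z]"
      using hypersum_mult[of a "[x, y, z]"] a' c by (simp del: hypersum.simps)
    ultimately have "image_mset (\<lambda>x. a \<otimes> x) \<alpha> \<in> null (hyperfield_pasture H)"
      using hyperfield_pasture_null_iff a' c by simp
    then show "image_mset (\<lambda>x. a \<otimes>\<^bsub>hyperfield_pasture H\<^esub> x) \<alpha> \<in> null (hyperfield_pasture H)"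
      by (simp add: hyperfield_pasture_def)
  next
    fix \<alpha> assume "\<alpha> \<in> null (hyperfield_pasture H)"
    then show "size \<alpha> \<le> 3" by (auto simp: hyperfield_pasture_def formal_def)
  qed
qed

end

end

(* Hypersums of multisets are well defined, and a sum of x_1, ..., x_n attains the value c iff there
   are partial sums b_i with b_(i+1) in b_i + x_(i+1), starting at 0 and ending at c. Each link of
   such a chain is a three-term relation of the pasture, and fusing the links along the b_i gives
   x_1 + ... + x_n - c, so fusion generates the null set of the tract. Conversely, fusion holds in
   the tract: by uniqueness of inverses -z is a hypersum of alpha and z is a hypersum of beta. *)
theory Submission
  imports Defs
begin

context hyperfield
begin

lemma hyperadd_mem_closed:
  "\<lbrakk>c \<in> a \<boxplus> b; a \<in> carrier H; b \<in> carrier H\<rbrakk> \<Longrightarrow> c \<in> carrier H"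
  using hyperadd_closed by blast

lemma hyperadd_assoc_iff:
  assumes "a \<in> carrier H" "b \<in> carrier H" "c \<in> carrier H"
  shows "(\<exists>d \<in> b \<boxplus> c. e \<in> a \<boxplus> d) \<longleftrightarrow> (\<exists>d \<in> a \<boxplus> b. e \<in> d \<boxplus> c)"
  using hyperadd_assoc[OF assms] by blast

text \<open>The guards on the carrier make \<open>hyperinsert\<close> commutative on the whole type, as
  \<^const>\<open>fold_mset\<close> requires.\<close>

definition hyperinsert :: "'a \<Rightarrow> 'a set \<Rightarrow> 'a set" where
  "hyperinsert a B = {c. a \<in> carrier H \<and> (\<exists>b \<in> B \<inter> carrier H. c \<in> b \<boxplus> a)}"

definition hypersum_mset :: "'a multiset \<Rightarrow> 'a set" where
  "hypersum_mset = fold_mset hyperinsert {\<zero>}"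

text \<open>Regroup (b + y) + x as b + (y + x), swap x and y, and regroup. One inclusion suffices: x
  and y are arbitrary, so exchanging them gives the other.\<close>

lemma hyperinsert_commute_mem:
  assumes "c \<in> hyperinsert x (hyperinsert y B)"
  shows "c \<in> hyperinsert y (hyperinsert x B)"
proof -
  obtain d b where x: "x \<in> carrier H" and y: "y \<in> carrier H" and b: "b \<in> B" "b \<in> carrier H"
    and d: "d \<in> b \<boxplus> y" "c \<in> d \<boxplus> x"
    using assms by (auto simp: hyperinsert_def)
  have "\<exists>d \<in> y \<boxplus> x. c \<in> b \<boxplus> d"
    using hyperadd_assoc_iff[OF b(2) y x] d by blast
  then have "\<exists>d \<in> b \<boxplus> x. c \<in> d \<boxplus> y"
    using hyperadd_assoc_iff[OF b(2) x y] hyperadd_comm[OF x y] by simp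
  \<comment> \<open>The new partial sum in \<open>b \<boxplus> x\<close> has to lie in the carrier
    to pass the guard of the outer \<open>hyperinsert\<close>.\<close>
  then show ?thesis
    using x y b hyperadd_mem_closed by (fastforce simp: hyperinsert_def)
qed

lemma comp_fun_commute_hyperinsert: "comp_fun_commute hyperinsert"
  by unfold_locales (auto simp: fun_eq_iff intro: hyperinsert_commute_mem)

lemma hypersum_mset_empty [simp]: "hypersum_mset {#} = {\<zero>}"
  by (simp add: hypersum_mset_def)

lemma hypersum_mset_add_mset:
  "hypersum_mset (add_mset a \<alpha>) = hyperinsert a (hypersum_mset \<alpha>)"
  by (simp add: hypersum_mset_def comp_fun_commute.fold_mset_add_mset[OF comp_fun_commute_hyperinsert])

text \<open>No condition on \<alpha> is needed: the guards of the outermost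
  \<open>hyperinsert\<close> already put its values in the carrier, so a case split replaces
  induction.\<close>

lemma hypersum_mset_closed: "hypersum_mset \<alpha> \<subseteq> carrier H"
  by (cases \<alpha>) (auto simp: hypersum_mset_add_mset hyperinsert_def dest: hyperadd_mem_closed)

lemma mem_hypersum_mset_add_mset:
  "a \<in> carrier H \<Longrightarrow>
    c \<in> hypersum_mset (add_mset a \<alpha>) \<longleftrightarrow> (\<exists>b \<in> hypersum_mset \<alpha>. c \<in> b \<boxplus> a)"
  using hypersum_mset_closed[of \<alpha>] by (auto simp: hypersum_mset_add_mset hyperinsert_def)

lemma hypersum_mset_single [simp]: "a \<in> carrier H \<Longrightarrow> hypersum_mset {#a#} = {a}"
  by (auto simp: mem_hypersum_mset_add_mset hyperadd_zero_left)

lemma hypersum_mset_formal [simp]: "a \<in> carrier H \<Longrightarrow> hypersum_mset (formal H a) = {a}"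
  by (simp add: formal_def)

lemma hypersum_eq_hypersum_mset:
  "set xs \<subseteq> carrier H \<Longrightarrow> hypersum H xs = hypersum_mset (mset xs)"
proof (induction xs rule: rev_induct)
  case (snoc a xs)
  then show ?case
    \<comment> \<open>The list recursion starts at its first term and the multiset fold at zero.
      They agree on one term because \<open>\<zero> \<boxplus> a = {a}\<close>.\<close>
    by (cases "xs = []") (auto simp: hypersum_snoc mem_hypersum_mset_add_mset)
qed simp

text \<open>Induction on \<beta>: its newest term x is added last to the whole sum, and
  associativity moves it inside the sum over \<beta>.\<close>

lemma mem_hypersum_mset_union:
  assumes "set_mset \<beta> \<subseteq> carrier H"
  shows "c \<in> hypersum_mset (\<alpha> + \<beta>) \<longleftrightarrow>
    (\<exists>a \<in> hypersum_mset \<alpha>. \<exists>b \<in> hypersum_mset \<beta>. c \<in> a \<boxplus> b)"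
  using assms
proof (induction \<beta> arbitrary: c)
  case empty
  then show ?case
    using hypersum_mset_closed[of \<alpha>] by (auto simp: hyperadd_zero_right subset_iff)
next
  case (add x \<beta>)
  have x: "x \<in> carrier H" using add.prems by simp
  have "c \<in> hypersum_mset (\<alpha> + add_mset x \<beta>) \<longleftrightarrow>
      (\<exists>a \<in> hypersum_mset \<alpha>. \<exists>b \<in> hypersum_mset \<beta>. \<exists>d \<in> a \<boxplus> b. c \<in> d \<boxplus> x)"
    using add.IH add.prems x by (simp add: mem_hypersum_mset_add_mset) blast
  also have "\<dots> \<longleftrightarrow>
      (\<exists>a \<in> hypersum_mset \<alpha>. \<exists>b \<in> hypersum_mset \<beta>. \<exists>d \<in> b \<boxplus> x. c \<in> a \<boxplus> d)"
    using hyperadd_assoc_iff[OF _ _ x] hypersum_mset_closed by (meson subsetD)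
  also have "\<dots> \<longleftrightarrow>
      (\<exists>a \<in> hypersum_mset \<alpha>. \<exists>d \<in> hypersum_mset (add_mset x \<beta>). c \<in> a \<boxplus> d)"
    using mem_hypersum_mset_add_mset[OF x] by blast
  finally show ?case .
qed

lemma null_hyperfield_tract_iff:
  "\<alpha> \<in> null (hyperfield_tract H) \<longleftrightarrow> set_mset \<alpha> \<subseteq> nonzero H \<and> \<zero> \<in> hypersum_mset \<alpha>"
proof -
  have *: "hypersum H xs = hypersum_mset (mset xs)" if "set xs \<subseteq> nonzero H" for xs
    using that by (intro hypersum_eq_hypersum_mset) (auto simp: nonzero_def)
  obtain xs where "\<alpha> = mset xs" by (metis ex_mset)
  then show ?thesis
    by (auto simp: hyperfield_tract_def * simp flip: set_mset_mset)
qed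

lemma null_pasture_subset_null_tract:
  "null (hyperfield_pasture H) \<subseteq> null (hyperfield_tract H)"
proof
  fix \<alpha> assume "\<alpha> \<in> null (hyperfield_pasture H)"
  then obtain x y z where c: "x \<in> carrier H" "y \<in> carrier H" "z \<in> carrier H"
    and s: "\<zero> \<in> hypersum H [x, y, z]" and \<alpha>: "\<alpha> = formal H x + formal H y + formal H z"
    unfolding hyperfield_pasture_def tract.simps mem_Collect_eq by blast
  have nz: "set_mset (formal H u) \<subseteq> carrier H" if "u \<in> carrier H" for u
    using formal_nonzero[OF that] by (auto simp: nonzero_def)
  have "\<zero> \<in> hypersum_mset \<alpha>"
    using s c by (auto simp: \<alpha> Bex_def mem_hypersum_mset_union nz)
  then show "\<alpha> \<in> null (hyperfield_tract H)"
    using formal_nonzero c by (auto simp: null_hyperfield_tract_iff \<alpha>)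
qed

lemma minus_one_pasture:
  "minus_one (hyperfield_pasture H) \<in> nonzero H"
  "\<zero> \<in> \<one> \<boxplus> minus_one (hyperfield_pasture H)"
proof -
  interpret P: pasture "hyperfield_pasture H"
    by (rule pasture_hyperfield_pasture)
  let ?e = "minus_one (hyperfield_pasture H)"
  have "?e \<in> nonzero (hyperfield_pasture H) \<and>
      {#\<one>\<^bsub>hyperfield_pasture H\<^esub>#} + {#?e#} \<in> null (hyperfield_pasture H)"
    unfolding minus_one_def by (rule theI'[OF P.T2])
  then have e: "?e \<in> nonzero H" and n: "{#\<one>#} + {#?e#} \<in> null (hyperfield_pasture H)"
    by (simp_all add: hyperfield_pasture_def nonzero_def)
  show "?e \<in> nonzero H" by (rule e)
  have ec: "?e \<in> carrier H" using e by (simp add: nonzero_def)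
  \<comment> \<open>Passing to the null set of the tract turns the two-term relation from T2 into a
    statement about hypersums.\<close>
  have "\<zero> \<in> hypersum_mset ({#\<one>#} + {#?e#})"
    using n null_pasture_subset_null_tract null_hyperfield_tract_iff by blast
  then show "\<zero> \<in> \<one> \<boxplus> ?e"
    using ec by (subst (asm) mem_hypersum_mset_union) auto
qed

text \<open>Multiplying \<open>\<zero> \<in> \<one> \<boxplus> \<epsilon>\<close> by a and
  distributing shows that \<epsilon>a is an additive inverse of a; such inverses are unique. Thus
  the sign of the pasture is hyperfield negation.\<close>

lemma zero_mem_hyperadd_iff:
  assumes "a \<in> carrier H" "b \<in> carrier H"
  shows "\<zero> \<in> a \<boxplus> b \<longleftrightarrow> b = minus_one (hyperfield_pasture H) \<otimes> a"
proof -
  let ?e = "minus_one (hyperfield_pasture H)"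
  have e: "?e \<in> carrier H" using minus_one_pasture(1) by (simp add: nonzero_def)
  have "a \<otimes> \<zero> \<in> (\<lambda>d. a \<otimes> d) ` (\<one> \<boxplus> ?e)"
    using minus_one_pasture(2) by (rule imageI)
  then have "\<zero> \<in> a \<boxplus> (?e \<otimes> a)"
    using distrib[of a \<one> ?e] assms e by (simp add: m_comm)
  then show ?thesis
    using hyperadd_inverse[OF assms(1)] assms e by blast
qed

text \<open>Being additive inverses is a symmetric relation, so a is the inverse of its own
  inverse.\<close>

lemma minus_one_minus_one:
  assumes "a \<in> carrier H"
  shows "minus_one (hyperfield_pasture H) \<otimes> (minus_one (hyperfield_pasture H) \<otimes> a) = a"
proof -
  have "minus_one (hyperfield_pasture H) \<otimes> a \<in> carrier H"
    using minus_one_pasture(1) assms by (simp add: nonzero_def)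
  then show ?thesis
    using zero_mem_hyperadd_iff assms hyperadd_comm by metis
qed

lemma fusion_hyperfield_tract: "fusion (hyperfield_pasture H) (null (hyperfield_tract H))"
proof -
  let ?e = "minus_one (hyperfield_pasture H)"
  have e: "?e \<in> carrier H" using minus_one_pasture(1) by (simp add: nonzero_def)
  have "\<alpha> + \<beta> \<in> null (hyperfield_tract H)"
    if ss: "set_mset \<alpha> \<subseteq> nonzero H" "set_mset \<beta> \<subseteq> nonzero H" and z: "z \<in> carrier H"
      and n: "\<alpha> + formal H z \<in> null (hyperfield_tract H)"
        "\<beta> + formal H (?e \<otimes> z) \<in> null (hyperfield_tract H)" for \<alpha> \<beta> z
  proof -
    \<comment> \<open>Split the relation as \<open>\<zero> \<in> a \<boxplus> u\<close> with a a
      hypersum of \<gamma>; uniqueness of inverses forces a to be -u.\<close>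
    have cancel: "?e \<otimes> u \<in> hypersum_mset \<gamma>"
      if u: "u \<in> carrier H" and \<gamma>: "\<gamma> + formal H u \<in> null (hyperfield_tract H)" for \<gamma> u
    proof -
      have "set_mset (formal H u) \<subseteq> carrier H"
        using formal_nonzero[OF u] by (auto simp: nonzero_def)
      then obtain a where a: "a \<in> hypersum_mset \<gamma>" "\<zero> \<in> a \<boxplus> u"
        using \<gamma> u by (auto simp: null_hyperfield_tract_iff mem_hypersum_mset_union)
      moreover have "a \<in> carrier H" using a(1) hypersum_mset_closed by blast
      ultimately show ?thesis
        using zero_mem_hyperadd_iff[of u a] hyperadd_comm[of a u] u by simp
    qed
    \<comment> \<open>The second use of \<open>cancel\<close> takes u = -z and yields -(-z) =
      z.\<close>
    have "?e \<otimes> z \<in> hypersum_mset \<alpha>" "z \<in> hypersum_mset \<beta>"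
      using cancel[OF z n(1)] cancel[OF _ n(2)] z e minus_one_minus_one by auto
    moreover have "\<zero> \<in> (?e \<otimes> z) \<boxplus> z"
      using zero_mem_hyperadd_iff[of "?e \<otimes> z" z] minus_one_minus_one z e by simp
    moreover have "set_mset \<beta> \<subseteq> carrier H" using ss by (auto simp: nonzero_def)
    ultimately show ?thesis
      using ss by (auto simp: null_hyperfield_tract_iff mem_hypersum_mset_union)
  qed
  then show ?thesis
    by (auto simp: fusion_def group_semiring_def hyperfield_pasture_def nonzero_def formal_def)
qed

text \<open>The value c is arbitrary, not just zero, so that the induction can pass through the
  partial sums of a relation.\<close>

lemma hypersum_mset_minus_mem_fusion:
  assumes N: "null (hyperfield_pasture H) \<subseteq> N" "fusion (hyperfield_pasture H) N"
    and "set_mset \<alpha> \<subseteq> nonzero H" "c \<in> hypersum_mset \<alpha>"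
  shows "\<alpha> + formal H (minus_one (hyperfield_pasture H) \<otimes> c) \<in> N"
  using assms(3,4)
proof (induction \<alpha> arbitrary: c)
  let ?e = "minus_one (hyperfield_pasture H)"
  have e: "?e \<in> carrier H" using minus_one_pasture(1) by (simp add: nonzero_def)
  {
    case empty
    \<comment> \<open>The only value of the empty sum is c = 0, and -c then contributes no
      term.\<close>
    have "{#} \<in> null (hyperfield_pasture H)"
      using pasture_hyperfield_pasture by (simp add: pasture_def tract.T1)
    then show ?case
      using N(1) empty e by (auto simp: formal_def)
  next
    case (add a \<alpha>)
    have a: "a \<in> carrier H" "formal H a = {#a#}"
      using add.prems(1) by (auto simp: nonzero_def formal_def)
    obtain b where b: "b \<in> hypersum_mset \<alpha>" "c \<in> b \<boxplus> a"
      using add.prems(2) a by (auto simp: mem_hypersum_mset_add_mset)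
    have bc: "b \<in> carrier H" "c \<in> carrier H"
      using b a hypersum_mset_closed hyperadd_mem_closed by blast+
    \<comment> \<open>As c lies in \<open>b \<boxplus> a\<close>, this makes b + a - c a three-term
      relation of the pasture.\<close>
    have "\<zero> \<in> c \<boxplus> (?e \<otimes> c)"
      using zero_mem_hyperadd_iff bc e by simp
    then have "\<zero> \<in> hypersum H [b, a, ?e \<otimes> c]"
      using b(2) by auto
    then have "formal H b + formal H a + formal H (?e \<otimes> c) \<in> N"
      using N(1) hyperfield_pasture_null_iff[of b a "?e \<otimes> c"] a bc e by auto
    \<comment> \<open>Fusion will be applied with z = -b, the term supplied by the induction
      hypothesis. The term b of the link is therefore written as -(-b) to have the form -z.\<close>
    then have link: "({#a#} + formal H (?e \<otimes> c)) + formal H (?e \<otimes> (?e \<otimes> b)) \<in> N"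
      using a bc minus_one_minus_one by (simp add: ac_simps)
    \<comment> \<open>Fusion restated with the carrier, zero and formal sums of \<open>H\<close> in
      place of those of the pasture.\<close>
    have step: "\<beta> + \<gamma> \<in> N"
      if "set_mset \<beta> \<subseteq> nonzero H" "set_mset \<gamma> \<subseteq> nonzero H" "z \<in> carrier H"
        "\<beta> + formal H z \<in> N" "\<gamma> + formal H (?e \<otimes> z) \<in> N" for \<beta> \<gamma> z
      using N(2) that
      by (auto simp: fusion_def group_semiring_def hyperfield_pasture_def nonzero_def formal_def)
    have "\<alpha> + ({#a#} + formal H (?e \<otimes> c)) \<in> N"
    proof (rule step)
      show "\<alpha> + formal H (?e \<otimes> b) \<in> N" using add b by auto
      show "set_mset ({#a#} + formal H (?e \<otimes> c)) \<subseteq> nonzero H"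
        using add.prems(1) formal_nonzero bc e by simp
    qed (use link add.prems(1) bc e in auto)
    then show ?case by simp
  }
qed

text \<open>This is the value c = 0 of the preceding result, where -c is the empty formal
  sum.\<close>

lemma null_tract_subset_fusion:
  assumes "null (hyperfield_pasture H) \<subseteq> N" "fusion (hyperfield_pasture H) N"
  shows "null (hyperfield_tract H) \<subseteq> N"
proof
  fix \<alpha> assume "\<alpha> \<in> null (hyperfield_tract H)"
  then have "\<alpha> + formal H (minus_one (hyperfield_pasture H) \<otimes> \<zero>) \<in> N"
    using hypersum_mset_minus_mem_fusion[OF assms] by (simp add: null_hyperfield_tract_iff)
  then show "\<alpha> \<in> N"
    using minus_one_pasture(1) by (simp add: formal_def nonzero_def)
qed

end

theorem proposition1p10:
  fixes H :: "('a, 'm) hyperring_scheme"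
  assumes "hyperfield H"
  shows "hyperfield_tract H = fusion_closure (hyperfield_pasture H)"
proof -
  interpret hyperfield H by (rule assms)
  have "null (hyperfield_tract H) \<subseteq> group_semiring (nonzero (hyperfield_pasture H))"
    by (auto simp: hyperfield_tract_def hyperfield_pasture_def group_semiring_def nonzero_def)
  then have "null (hyperfield_tract H) =
      \<Inter>{N. N \<subseteq> group_semiring (nonzero (hyperfield_pasture H)) \<and>
        null (hyperfield_pasture H) \<subseteq> N \<and> fusion (hyperfield_pasture H) N}"
    \<comment> \<open>The null set of the tract is itself a member of the intersected family and
      lies in every other member.\<close>
    using null_pasture_subset_null_tract fusion_hyperfield_tract null_tract_subset_fusion by blast
  then show ?thesis
    by (simp add: fusion_closure_def hyperfield_tract_def hyperfield_pasture_def)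
qed

end
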